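(* Let $\langle D;<\rangle$ be a (strict) linear order. Then $\langle D;<\rangle$ satisfies the scheme $\mathtt{D\text{-}Sup}$ if and only if it satisfies the scheme $\mathtt{D\text{-}Cut}$.
   Context: Formulas are first-order formulas in the language $\{<\}$; a scheme holds in a structure if every instance (with further free variables read universally, as parameters) is true in it. $\mathtt{D\text{-}Sup}$ is the scheme $$\exists x\,\varphi(x)\wedge\exists y\,\forall x\,[\varphi(x)\rightarrow x\leqslant y]\longrightarrow\exists z\,\forall y\,\big(\forall x\,[\varphi(x)\rightarrow x\leqslant y]\leftrightarrow z\leqslant y\big)$$ for arbitrary formulas $\varphi$, and $\mathtt{D\text{-}Cut}$ is the scheme $$\exists x\,\exists y\,[\varphi(x)\wedge\psi(y)]\wedge\forall x\,\forall y\,[\varphi(x)\wedge\psi(y)\rightarrow x<y]\longrightarrow\exists z\,\forall x\,\forall y\,[\varphi(x)\wedge\psi(y)\rightarrow x\leqslant z\leqslant y]$$ for arbitrary formulas $\varphi,\psi$. *)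

theory Defs
  imports Main
begin

text \<open>First-order logic with equality over the signature consisting of one binary relation
  symbol. Individual variables are named by natural numbers.\<close>

datatype fm =
    Eq nat nat
  | Less nat nat
  | Neg fm
  | And fm fm
  | Or fm fm
  | Imp fm fm
  | Iff fm fm
  | All nat fm
  | Ex nat fm

primrec free_vars :: "fm \<Rightarrow> nat set" where
  "free_vars (Eq i j) = {i, j}"
| "free_vars (Less i j) = {i, j}"
| "free_vars (Neg \<phi>) = free_vars \<phi>"
| "free_vars (And \<phi> \<psi>) = free_vars \<phi> \<union> free_vars \<psi>"
| "free_vars (Or \<phi> \<psi>) = free_vars \<phi> \<union> free_vars \<psi>"
| "free_vars (Imp \<phi> \<psi>) = free_vars \<phi> \<union> free_vars \<psi>"
| "free_vars (Iff \<phi> \<psi>) = free_vars \<phi> \<union> free_vars \<psi>"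
| "free_vars (All i \<phi>) = free_vars \<phi> - {i}"
| "free_vars (Ex i \<phi>) = free_vars \<phi> - {i}"

primrec sat :: "'a set \<Rightarrow> ('a \<times> 'a) set \<Rightarrow> (nat \<Rightarrow> 'a) \<Rightarrow> fm \<Rightarrow> bool" where
  "sat D r v (Eq i j) \<longleftrightarrow> v i = v j"
| "sat D r v (Less i j) \<longleftrightarrow> (v i, v j) \<in> r"
| "sat D r v (Neg \<phi>) \<longleftrightarrow> \<not> sat D r v \<phi>"
| "sat D r v (And \<phi> \<psi>) \<longleftrightarrow> sat D r v \<phi> \<and> sat D r v \<psi>"
| "sat D r v (Or \<phi> \<psi>) \<longleftrightarrow> sat D r v \<phi> \<or> sat D r v \<psi>"
| "sat D r v (Imp \<phi> \<psi>) \<longleftrightarrow> (sat D r v \<phi> \<longrightarrow> sat D r v \<psi>)"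
| "sat D r v (Iff \<phi> \<psi>) \<longleftrightarrow> (sat D r v \<phi> \<longleftrightarrow> sat D r v \<psi>)"
| "sat D r v (All i \<phi>) \<longleftrightarrow> (\<forall>d\<in>D. sat D r (v(i := d)) \<phi>)"
| "sat D r v (Ex i \<phi>) \<longleftrightarrow> (\<exists>d\<in>D. sat D r (v(i := d)) \<phi>)"

text \<open>Ranging over all valuations into the domain reads the remaining free variables of a
  formula universally.\<close>

definition holds_in :: "'a set \<Rightarrow> ('a \<times> 'a) set \<Rightarrow> fm \<Rightarrow> bool" where
  "holds_in D r \<phi> \<longleftrightarrow> (\<forall>v. range v \<subseteq> D \<longrightarrow> sat D r v \<phi>)"

definition scheme_holds_in :: "'a set \<Rightarrow> ('a \<times> 'a) set \<Rightarrow> fm set \<Rightarrow> bool" where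
  "scheme_holds_in D r S \<longleftrightarrow> (\<forall>\<phi>\<in>S. holds_in D r \<phi>)"

definition Leq :: "nat \<Rightarrow> nat \<Rightarrow> fm" where
  "Leq i j = Or (Less i j) (Eq i j)"

definition sup_instance :: "nat \<Rightarrow> nat \<Rightarrow> nat \<Rightarrow> fm \<Rightarrow> fm" where
  "sup_instance x y z \<phi> =
     Imp (And (Ex x \<phi>) (Ex y (All x (Imp \<phi> (Leq x y)))))
         (Ex z (All y (Iff (All x (Imp \<phi> (Leq x y))) (Leq z y))))"

definition cut_instance :: "nat \<Rightarrow> nat \<Rightarrow> nat \<Rightarrow> fm \<Rightarrow> fm \<Rightarrow> fm" where
  "cut_instance x y z \<phi> \<psi> =
     Imp (And (Ex x (Ex y (And \<phi> \<psi>))) (All x (All y (Imp (And \<phi> \<psi>) (Less x y)))))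
         (Ex z (All x (All y (Imp (And \<phi> \<psi>) (And (Leq x z) (Leq z y))))))"

text \<open>Writing \<open>\<phi>(x)\<close> and \<open>\<psi>(y)\<close> singles out one variable of each formula; all other variables may
  occur as parameters, except that none may be captured by the quantifiers of the scheme. The
  side conditions express exactly this, \<open>x\<close>, \<open>y\<close>, \<open>z\<close> being arbitrary distinct variables.\<close>

definition D_Sup :: "fm set" where
  "D_Sup = {sup_instance x y z \<phi> | x y z \<phi>.
     distinct [x, y, z] \<and> y \<notin> free_vars \<phi> \<and> z \<notin> free_vars \<phi>}"

definition D_Cut :: "fm set" where
  "D_Cut = {cut_instance x y z \<phi> \<psi> | x y z \<phi> \<psi>.
     distinct [x, y, z] \<and> y \<notin> free_vars \<phi> \<and> z \<notin> free_vars \<phi> \<and>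
     x \<notin> free_vars \<psi> \<and> z \<notin> free_vars \<psi>}"

end

theory Submission
  imports Defs
begin

text \<open>The least upper bound of \<open>\<phi>\<close> separates \<open>\<phi>\<close> from any \<open>\<psi>\<close> lying above it. Conversely, the upper
  bounds of \<open>\<phi>\<close> are defined by the formula \<open>\<forall>x (\<phi>(x) \<longrightarrow> x \<le> y)\<close>: if one of them satisfies \<open>\<phi>\<close>, it is
  the supremum; otherwise \<open>\<phi>\<close> lies strictly below its upper bounds, and any point of the cut
  is the supremum.\<close>

lemma sat_cong:
  assumes "\<And>i. i \<in> free_vars \<phi> \<Longrightarrow> v i = w i"
  shows "sat D r v \<phi> \<longleftrightarrow> sat D r w \<phi>"
  using assms
proof (induction \<phi> arbitrary: v w)
  case (All i \<phi>)
  have "sat D r (v(i := d)) \<phi> \<longleftrightarrow> sat D r (w(i := d)) \<phi>" for d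
    by (rule All.IH) (use All.prems in auto)
  then show ?case by simp
next
  case (Ex i \<phi>)
  have "sat D r (v(i := d)) \<phi> \<longleftrightarrow> sat D r (w(i := d)) \<phi>" for d
    by (rule Ex.IH) (use Ex.prems in auto)
  then show ?case by simp
next
  case (And \<phi> \<psi>)
  show ?case using And.IH[of v w] And.prems by simp
next
  case (Or \<phi> \<psi>)
  show ?case using Or.IH[of v w] Or.prems by simp
next
  case (Imp \<phi> \<psi>)
  show ?case using Imp.IH[of v w] Imp.prems by simp
next
  case (Iff \<phi> \<psi>)
  show ?case using Iff.IH[of v w] Iff.prems by simp
next
  case (Neg \<phi>)
  show ?case using Neg.IH[of v w] Neg.prems by simp
qed simp_all

lemma sat_upd_fresh [simp]:
  "i \<notin> free_vars \<phi> \<Longrightarrow> sat D r (v(i := d)) \<phi> \<longleftrightarrow> sat D r v \<phi>"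
  by (rule sat_cong) auto

lemma sat_Leq [simp]: "sat D r v (Leq i j) \<longleftrightarrow> (v i, v j) \<in> r\<^sup>="
  by (auto simp: Leq_def)

lemma free_vars_Leq [simp]: "free_vars (Leq i j) = {i, j}"
  by (simp add: Leq_def)

text \<open>Turns an instance into a statement about the definable set \<open>A\<close>, leaving
  only order theory for the main implications. Freshness of \<open>y\<close> and \<open>z\<close>
  makes \<open>A\<close> independent of the values they receive.\<close>

lemma sat_sup_instance:
  fixes D :: "'a set" and r :: "('a \<times> 'a) set" and v :: "nat \<Rightarrow> 'a"
  assumes "distinct [x, y, z]" "y \<notin> free_vars \<phi>" "z \<notin> free_vars \<phi>"
  defines "A \<equiv> {a \<in> D. sat D r (v(x := a)) \<phi>}"
  shows "sat D r v (sup_instance x y z \<phi>) \<longleftrightarrow>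
    (A \<noteq> {} \<and> (\<exists>b\<in>D. \<forall>a\<in>A. (a, b) \<in> r\<^sup>=) \<longrightarrow>
      (\<exists>c\<in>D. \<forall>b\<in>D. (\<forall>a\<in>A. (a, b) \<in> r\<^sup>=) \<longleftrightarrow> (c, b) \<in> r\<^sup>=))"
proof -
  have "sat D r (v(y := b, x := a)) \<phi> \<longleftrightarrow> sat D r (v(x := a)) \<phi>"
    "sat D r (v(z := c, y := b, x := a)) \<phi> \<longleftrightarrow> sat D r (v(x := a)) \<phi>" for a b c
    using assms(1-3) by (intro sat_cong; force)+
  then show ?thesis
    using assms(1) unfolding A_def sup_instance_def by (simp add: Ball_def Bex_def imp_conjL)
qed

text \<open>Each formula depends on only one of the values given to \<open>x\<close> and
  \<open>y\<close>, so quantification over pairs satisfying both formulas splits into quantification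
  over \<open>A\<close> and over \<open>B\<close>.\<close>

lemma sat_cut_instance:
  fixes D :: "'a set" and r :: "('a \<times> 'a) set" and v :: "nat \<Rightarrow> 'a"
  assumes "distinct [x, y, z]" "y \<notin> free_vars \<phi>" "z \<notin> free_vars \<phi>"
    "x \<notin> free_vars \<psi>" "z \<notin> free_vars \<psi>"
  defines "A \<equiv> {a \<in> D. sat D r (v(x := a)) \<phi>}"
    and "B \<equiv> {b \<in> D. sat D r (v(y := b)) \<psi>}"
  shows "sat D r v (cut_instance x y z \<phi> \<psi>) \<longleftrightarrow>
    (A \<noteq> {} \<and> B \<noteq> {} \<and> (\<forall>a\<in>A. \<forall>b\<in>B. (a, b) \<in> r) \<longrightarrow>
      (\<exists>c\<in>D. \<forall>a\<in>A. \<forall>b\<in>B. (a, c) \<in> r\<^sup>= \<and> (c, b) \<in> r\<^sup>=))"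
proof -
  have \<phi>: "sat D r (v(x := a, y := b)) \<phi> \<longleftrightarrow> sat D r (v(x := a)) \<phi>"
    "sat D r (v(z := c, x := a, y := b)) \<phi> \<longleftrightarrow> sat D r (v(x := a)) \<phi>" for a b c
    using assms(1-3) by (intro sat_cong; force)+
  have \<psi>: "sat D r (v(x := a, y := b)) \<psi> \<longleftrightarrow> sat D r (v(y := b)) \<psi>"
    "sat D r (v(z := c, x := a, y := b)) \<psi> \<longleftrightarrow> sat D r (v(y := b)) \<psi>" for a b c
    using assms(1,4,5) by (intro sat_cong; force)+
  show ?thesis
    using assms(1) unfolding A_def B_def cut_instance_def by (simp add: \<phi> \<psi> Ball_def Bex_def imp_conjL)
qed

lemma D_Cut_if_D_Sup:
  fixes D :: "'a set"
  assumes "scheme_holds_in D r D_Sup"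
  shows "scheme_holds_in D r D_Cut"
  unfolding scheme_holds_in_def holds_in_def
proof (intro ballI allI impI)
  fix \<chi> and v :: "nat \<Rightarrow> 'a"
  assume "\<chi> \<in> D_Cut" and v: "range v \<subseteq> D"
  then obtain x y z \<phi> \<psi> where \<chi>: "\<chi> = cut_instance x y z \<phi> \<psi>"
    and xyz: "distinct [x, y, z]" "y \<notin> free_vars \<phi>" "z \<notin> free_vars \<phi>"
      "x \<notin> free_vars \<psi>" "z \<notin> free_vars \<psi>"
    unfolding D_Cut_def by blast
  have "sat D r v (sup_instance x y z \<phi>)"
    using assms v xyz unfolding scheme_holds_in_def holds_in_def D_Sup_def by blast
  \<comment> \<open>Any element defined by \<open>\<psi>\<close> bounds the set defined by
    \<open>\<phi>\<close>, so a supremum exists and lies below all such elements. Reading its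
    defining equivalence at the supremum itself, by reflexivity of \<open>\<le>\<close>, shows that
    it is an upper bound.\<close>
  then show "sat D r v \<chi>"
    unfolding \<chi> sat_cut_instance[OF xyz] sat_sup_instance[OF xyz(1-3)] by blast
qed

lemma D_Sup_if_D_Cut:
  fixes D :: "'a set"
  assumes "trans r" and "scheme_holds_in D r D_Cut"
  shows "scheme_holds_in D r D_Sup"
  unfolding scheme_holds_in_def holds_in_def
proof (intro ballI allI impI)
  fix \<chi> and v :: "nat \<Rightarrow> 'a"
  assume "\<chi> \<in> D_Sup" and v: "range v \<subseteq> D"
  then obtain x y z \<phi> where \<chi>: "\<chi> = sup_instance x y z \<phi>"
    and xyz: "distinct [x, y, z]" "y \<notin> free_vars \<phi>" "z \<notin> free_vars \<phi>"
    unfolding D_Sup_def by blast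
  \<comment> \<open>Binding \<open>x\<close> here and leaving \<open>y\<close> free meets the side
    conditions of \<open>D_Cut\<close> with the same three variables; the parameters of
    \<open>\<phi>\<close> stay parameters.\<close>
  define \<psi> where "\<psi> = All x (Imp \<phi> (Leq x y))"
  have \<psi>: "x \<notin> free_vars \<psi>" "z \<notin> free_vars \<psi>"
    using xyz by (auto simp: \<psi>_def)
  define A where "A = {a \<in> D. sat D r (v(x := a)) \<phi>}"
  define U where "U = {b \<in> D. \<forall>a\<in>A. (a, b) \<in> r\<^sup>=}"
  \<comment> \<open>Swapping the two updates puts the one at \<open>y\<close> outermost, where
    \<open>sat_upd_fresh\<close> removes it for \<open>\<phi>\<close>.\<close>
  have U: "{b \<in> D. sat D r (v(y := b)) \<psi>} = U"
    using xyz unfolding U_def A_def \<psi>_def by (auto simp: fun_upd_twist[of y x])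
  have cut: "A \<noteq> {} \<and> U \<noteq> {} \<and> (\<forall>a\<in>A. \<forall>b\<in>U. (a, b) \<in> r) \<longrightarrow>
      (\<exists>c\<in>D. \<forall>a\<in>A. \<forall>b\<in>U. (a, c) \<in> r\<^sup>= \<and> (c, b) \<in> r\<^sup>=)"
  proof -
    have "sat D r v (cut_instance x y z \<phi> \<psi>)"
      using assms(2) v xyz \<psi> unfolding scheme_holds_in_def holds_in_def D_Cut_def by blast
    then show ?thesis
      unfolding sat_cut_instance[OF xyz \<psi>] U A_def[symmetric] .
  qed
  have "\<exists>c\<in>D. \<forall>b\<in>D. (\<forall>a\<in>A. (a, b) \<in> r\<^sup>=) \<longleftrightarrow> (c, b) \<in> r\<^sup>=" if ne: "A \<noteq> {}" "U \<noteq> {}"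
  proof -
    obtain c where c: "c \<in> D" "\<forall>a\<in>A. (a, c) \<in> r\<^sup>=" "\<forall>b\<in>U. (c, b) \<in> r\<^sup>="
    proof (cases "A \<inter> U = {}")
      case True
      \<comment> \<open>Equality of \<open>a\<close> and \<open>b\<close> would give a common
        element.\<close>
      then have "\<forall>a\<in>A. \<forall>b\<in>U. (a, b) \<in> r"
        unfolding U_def by blast
      with cut ne obtain c where "c \<in> D" "\<forall>a\<in>A. \<forall>b\<in>U. (a, c) \<in> r\<^sup>= \<and> (c, b) \<in> r\<^sup>="
        by blast
      \<comment> \<open>The two bounds on \<open>c\<close> hold only for pairs; a fixed element of
        \<open>U\<close> yields the first for all of \<open>A\<close>, and a fixed element of
        \<open>A\<close> yields the second for all of \<open>U\<close>.\<close>
      with ne show ?thesis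
        by (intro that[of c]) blast+
    next
      case False
      then show ?thesis
        using that unfolding U_def A_def by blast
    qed
    \<comment> \<open>This is the direction from \<open>c \<le> b\<close> to \<open>b\<close> being
      an upper bound; the other is minimality of \<open>c\<close> over \<open>U\<close>.\<close>
    have "(a, b) \<in> r\<^sup>=" if "a \<in> A" "(c, b) \<in> r\<^sup>=" for a b
      using c(2) that \<open>trans r\<close> by (auto dest: transD)
    with c show ?thesis
      unfolding U_def by blast
  qed
  then show "sat D r v \<chi>"
    unfolding \<chi> sat_sup_instance[OF xyz] A_def[symmetric] U_def by blast
qed

theorem theorem3p5:
  fixes D :: "'a set" and r :: "('a \<times> 'a) set"
  assumes "strict_linear_order_on D r"
  shows "scheme_holds_in D r D_Sup \<longleftrightarrow> scheme_holds_in D r D_Cut"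
  using assms D_Cut_if_D_Sup D_Sup_if_D_Cut unfolding strict_linear_order_on_def by blast

end
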